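(* Let $\{U_k^{(n)}\}_{-1\le k\le K+1}$, $\{P_k^{(n)}\}_{-1\le k\le K+1}$ $(n=0,1,\ldots)$ be a solution of the scheme (S) given in the context. Then $$\delta_n^{+}M_{\rm d}(\boldsymbol U^{(n)})=0\qquad(n=0,1,\ldots).$$
   Context: Let $L>0$, $\gamma>0$, $K$ a natural number, $\Delta x:=L/K$, and let $\Delta t>0$ be a time mesh size. $F:\mathbb R\to\mathbb R$ is a continuously differentiable potential, bounded from below. Difference operators: $\delta_k^{\langle1\rangle}f_k=\frac{f_{k+1}-f_{k-1}}{2\Delta x}$, $\delta_k^{\langle2\rangle}f_k=\frac{f_{k+1}-2f_k+f_{k-1}}{(\Delta x)^2}$, and $\delta_n^+f^{(n)}=\frac{f^{(n+1)}-f^{(n)}}{\Delta t}$. Difference quotient: $\frac{dF}{d(\xi,\eta)}:=\frac{F(\xi)-F(\eta)}{\xi-\eta}$ if $\xi\ne\eta$, and $:=F'(\eta)$ if $\xi=\eta$. Discrete mass: $M_{\rm d}(\boldsymbol U):=\Big(\frac12U_0+\sum_{k=1}^{K-1}U_k+\frac12U_K\Big)\Delta x$. Scheme (S): for all $n=0,1,\ldots$, (1) $\frac{U_k^{(n+1)}-U_k^{(n)}}{\Delta t}=\delta_k^{\langle2\rangle}P_k^{(n)}$ for $k=0,\ldots,K$; (2) $P_k^{(n)}=-\gamma\,\delta_k^{\langle2\rangle}\Big(\frac{U_k^{(n+1)}+U_k^{(n)}}{2}\Big)+\frac{dF}{d(U_k^{(n+1)},U_k^{(n)})}$ for $k=0,\ldots,K$;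 (3) $\frac{U_0^{(n+1)}-U_0^{(n)}}{\Delta t}=\delta_k^{\langle1\rangle}\Big(\frac{U_k^{(n+1)}+U_k^{(n)}}{2}\Big)\Big|_{k=0}$; (4) $\frac{U_K^{(n+1)}-U_K^{(n)}}{\Delta t}=-\delta_k^{\langle1\rangle}\Big(\frac{U_k^{(n+1)}+U_k^{(n)}}{2}\Big)\Big|_{k=K}$; (5) $\delta_k^{\langle1\rangle}P_k^{(n)}=0$ for $k=0,K$. The values at $k=-1$ and $k=K+1$ are artificial (ghost) quantities. *)

theory Defs
  imports "HOL-Analysis.Analysis"
begin

text \<open>
  Grid functions have type \<open>int \<Rightarrow> real\<close>, so that the ghost indices \<open>k = -1\<close> and \<open>k = K + 1\<close>
  are available. Only the values at \<open>-1 \<le> k \<le> K + 1\<close> occur in the scheme and in the mass.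
  A time-dependent grid function \<open>U\<^sub>k\<^sup>(\<^sup>n\<^sup>)\<close> is written \<open>U n k\<close>.
\<close>

definition central_diff1 :: "real \<Rightarrow> (int \<Rightarrow> real) \<Rightarrow> int \<Rightarrow> real" where
  "central_diff1 dx f k = (f (k + 1) - f (k - 1)) / (2 * dx)"

definition central_diff2 :: "real \<Rightarrow> (int \<Rightarrow> real) \<Rightarrow> int \<Rightarrow> real" where
  "central_diff2 dx f k = (f (k + 1) - 2 * f k + f (k - 1)) / dx\<^sup>2"

definition forward_diff :: "real \<Rightarrow> (nat \<Rightarrow> real) \<Rightarrow> nat \<Rightarrow> real" where
  "forward_diff dt f n = (f (n + 1) - f n) / dt"

definition diff_quotient :: "(real \<Rightarrow> real) \<Rightarrow> real \<Rightarrow> real \<Rightarrow> real" where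
  "diff_quotient F \<xi> \<eta> = (if \<xi> \<noteq> \<eta> then (F \<xi> - F \<eta>) / (\<xi> - \<eta>) else deriv F \<eta>)"

definition discrete_mass :: "real \<Rightarrow> nat \<Rightarrow> (int \<Rightarrow> real) \<Rightarrow> real" where
  "discrete_mass dx K u =
     (1/2 * u 0 + (\<Sum>k = 1..int K - 1. u k) + 1/2 * u (int K)) * dx"

definition time_average :: "(nat \<Rightarrow> int \<Rightarrow> real) \<Rightarrow> nat \<Rightarrow> int \<Rightarrow> real" where
  "time_average U n k = (U (n + 1) k + U n k) / 2"

definition scheme_solution ::
  "real \<Rightarrow> (real \<Rightarrow> real) \<Rightarrow> real \<Rightarrow> nat \<Rightarrow> real \<Rightarrow>
   (nat \<Rightarrow> int \<Rightarrow> real) \<Rightarrow> (nat \<Rightarrow> int \<Rightarrow> real) \<Rightarrow> bool" where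
  "scheme_solution \<gamma> F dx K dt U P \<longleftrightarrow>
     (\<forall>n.
        (\<forall>k\<in>{0..int K}. (U (n + 1) k - U n k) / dt = central_diff2 dx (P n) k) \<and>
        (\<forall>k\<in>{0..int K}.
           P n k = - \<gamma> * central_diff2 dx (time_average U n) k
                   + diff_quotient F (U (n + 1) k) (U n k)) \<and>
        (U (n + 1) 0 - U n 0) / dt = central_diff1 dx (time_average U n) 0 \<and>
        (U (n + 1) (int K) - U n (int K)) / dt
          = - central_diff1 dx (time_average U n) (int K) \<and>
        (\<forall>k\<in>{0, int K}. central_diff1 dx (P n) k = 0))"

end

theory Submission
  imports Defs
begin

text \<open>
  The discrete mass is the trapezoidal sum, for which the second central difference telescopes:
  its mass is the difference of the first central differences at the two end points. By (1) the
  increment of the mass is therefore the discrete flux of \<open>P\<close> through the boundary, which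
  vanishes by (5).
\<close>

text \<open>Appending a cell raises the weight of node \<open>K\<close> from one half to one and
  gives the new end node weight one half: a trapezoid on the new cell. For \<open>K = 0\<close> both
  half weights lie on the same node and the set identity below fails.\<close>

lemma discrete_mass_Suc:
  assumes "K \<ge> 1"
  shows "discrete_mass dx (Suc K) u = discrete_mass dx K u + (u (int K) + u (int K + 1)) / 2 * dx"
proof -
  have "{1..int (Suc K) - 1} = insert (int K) {1..int K - 1}"
    using assms by auto
  then show ?thesis
    by (simp add: discrete_mass_def algebra_simps add_divide_distrib)
qed

lemma discrete_mass_central_diff2:
  assumes "K \<ge> 1" and "dx \<noteq> 0"
  shows "discrete_mass dx K (central_diff2 dx p) = central_diff1 dx p (int K) - central_diff1 dx p 0"
  using assms(1)
proof (induction K rule: nat_induct_at_least)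
  case base
  show ?case
    using assms(2)
    by (simp add: discrete_mass_def central_diff1_def central_diff2_def field_simps power2_eq_square)
next
  case (Suc K)
  \<comment> \<open>One-cell telescoping: averaging two neighbouring second differences matches the
    width \<open>2 * dx\<close> of the central first difference.\<close>
  have "(central_diff2 dx p (int K) + central_diff2 dx p (int K + 1)) / 2 * dx
      = central_diff1 dx p (int K + 1) - central_diff1 dx p (int K)"
    using assms(2)
    by (simp add: central_diff1_def central_diff2_def field_simps power2_eq_square)
  then show ?case
    \<comment> \<open>The simp setup keeps \<open>/ 2 * dx\<close> and \<open>int K + 1\<close> in
      the form of the one-cell identity.\<close>
    using Suc by (simp add: discrete_mass_Suc[OF Suc.hyps] add.commute[of 1] del: times_divide_eq_left)
qed

text \<open>The mass reads no ghost values, so an equation known only at the nodes \<open>0\<close>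
  to \<open>K\<close>, such as (1), can be substituted into it.\<close>

lemma discrete_mass_cong:
  assumes "\<And>k. k \<in> {0..int K} \<Longrightarrow> u k = v k"
  shows "discrete_mass dx K u = discrete_mass dx K v"
  using assms by (simp add: discrete_mass_def)

text \<open>Linearity of the mass lets the time difference act node by node.\<close>

lemma forward_diff_discrete_mass:
  "forward_diff dt (\<lambda>m. discrete_mass dx K (U m)) n
     = discrete_mass dx K (\<lambda>k. (U (n + 1) k - U n k) / dt)"
  by (simp add: forward_diff_def discrete_mass_def diff_divide_distrib sum_subtractf
      algebra_simps add_divide_distrib flip: sum_divide_distrib)

theorem theorem2p2:
  fixes L \<gamma> dx dt :: real and K :: nat and F :: "real \<Rightarrow> real"
    and U P :: "nat \<Rightarrow> int \<Rightarrow> real"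
  assumes "L > 0" and "\<gamma> > 0" and "K \<ge> 1" and "dt > 0"
    and "dx = L / real K"
    and "F C1_differentiable_on UNIV" and "bdd_below (range F)"
    and "scheme_solution \<gamma> F dx K dt U P"
  shows "\<forall>n. forward_diff dt (\<lambda>m. discrete_mass dx K (U m)) n = 0"
proof
  fix n
  have "dx \<noteq> 0"
    using assms(1,3,5) by simp
  have evolution: "(U (n + 1) k - U n k) / dt = central_diff2 dx (P n) k" if "k \<in> {0..int K}" for k
    using assms(8) that unfolding scheme_solution_def by blast
  have flux: "central_diff1 dx (P n) 0 = 0" "central_diff1 dx (P n) (int K) = 0"
    using assms(8) unfolding scheme_solution_def by blast+
  have "forward_diff dt (\<lambda>m. discrete_mass dx K (U m)) n = discrete_mass dx K (central_diff2 dx (P n))"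
    unfolding forward_diff_discrete_mass by (rule discrete_mass_cong) (rule evolution)
  \<comment> \<open>The ghost values of \<open>P n\<close> enter only through the two end-point
    differences, which \<open>flux\<close> sets to zero.\<close>
  also have "\<dots> = 0"
    using discrete_mass_central_diff2[OF assms(3) \<open>dx \<noteq> 0\<close>] flux by simp
  finally show "forward_diff dt (\<lambda>m. discrete_mass dx K (U m)) n = 0" .
qed

end
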